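(* There exist graphs $G,G'$ such that $G'$ is obtained from $G$ by adding one edge and $\lambda(G,K_2)<\lambda(G',K_2)$.
   Context: All graphs are finite and simple. For a graph $G$, $d_v$ denotes the degree of $v$, $u\sim v$ means adjacency, and $\mathrm{vol}(G)=\sum_v d_v$. For a metric space $(X,d)$ and $f:V(G)\to X$ set $R_f(G,X)=\frac{\mathrm{vol}(G)\sum_{u\sim v} d(f(u),f(v))^2}{\sum_{u,v} d(f(u),f(v))^2 d_u d_v}$, where the numerator sum is over edges of $G$ and the denominator sum over unordered pairs of vertices; $\lambda(G,X)=\inf_f R_f(G,X)$ over all $f$ with nonzero denominator. $K_2$ is regarded as a two-point metric space with distance $1$. *)

theory Defs
  imports "HOL-Analysis.Analysis"
begin

definition simple_graph :: "'a set \<Rightarrow> 'a set set \<Rightarrow> bool" where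
  "simple_graph V E \<longleftrightarrow> finite V \<and> E \<subseteq> {e. e \<subseteq> V \<and> card e = 2}"

definition degree :: "'a set set \<Rightarrow> 'a \<Rightarrow> nat" where
  "degree E v = card {e \<in> E. v \<in> e}"

definition vol :: "'a set \<Rightarrow> 'a set set \<Rightarrow> nat" where
  "vol V E = (\<Sum>v\<in>V. degree E v)"

text \<open>
  Sums over edges and over unordered pairs of vertices are written as halved sums over
  ordered pairs: every unordered pair of distinct vertices occurs twice as an ordered pair,
  and the diagonal pairs contribute nothing because the distance of a point to itself is zero.
\<close>

definition edge_energy :: "'a set \<Rightarrow> 'a set set \<Rightarrow> 'b metric \<Rightarrow> ('a \<Rightarrow> 'b) \<Rightarrow> real" where
  "edge_energy V E X f =
     (\<Sum>(u, v) \<in> {(u, v). u \<in> V \<and> v \<in> V \<and> {u, v} \<in> E}. (mdist X (f u) (f v))\<^sup>2) / 2"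

definition pair_energy :: "'a set \<Rightarrow> 'a set set \<Rightarrow> 'b metric \<Rightarrow> ('a \<Rightarrow> 'b) \<Rightarrow> real" where
  "pair_energy V E X f =
     (\<Sum>(u, v) \<in> V \<times> V. (mdist X (f u) (f v))\<^sup>2 * real (degree E u) * real (degree E v)) / 2"

definition rayleigh :: "'a set \<Rightarrow> 'a set set \<Rightarrow> 'b metric \<Rightarrow> ('a \<Rightarrow> 'b) \<Rightarrow> real" where
  "rayleigh V E X f = real (vol V E) * edge_energy V E X f / pair_energy V E X f"

text \<open>
  The infimum is taken in the extended reals, so that it is \<open>\<infinity>\<close> (and not an unspecified
  real number) if no map has a nonzero denominator, e.g. for an edgeless graph.
\<close>

definition lambda :: "'a set \<Rightarrow> 'a set set \<Rightarrow> 'b metric \<Rightarrow> ereal" where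
  "lambda V E X =
     (INF f \<in> {f. f \<in> V \<rightarrow> mspace X \<and> pair_energy V E X f \<noteq> 0}. ereal (rayleigh V E X f))"

definition K2 :: "bool metric" where
  "K2 = metric (UNIV, \<lambda>x y. if x = y then 0 else 1)"

text \<open>\<^const>\<open>metric\<close> is meaningful only on pairs satisfying the metric axioms; the following
  confirms that this is the case here.\<close>

lemma
  shows mspace_K2: "mspace K2 = UNIV"
    and mdist_K2: "mdist K2 x y = (if x = y then 0 else 1)"
proof -
  have "Metric_space (UNIV :: bool set) (\<lambda>x y. if x = y then 0 else 1)"
    by unfold_locales auto
  then show "mspace K2 = UNIV" "mdist K2 x y = (if x = y then 0 else 1)"
    by (simp_all add: K2_def Metric_space.mspace_metric Metric_space.mdist_metric)
qed

text \<open>The graph with edge set \<open>E'\<close> arises from the one with edge set \<open>E\<close>, on the same vertex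
  set, by joining two distinct non-adjacent vertices.\<close>

definition adds_one_edge :: "'a set \<Rightarrow> 'a set set \<Rightarrow> 'a set set \<Rightarrow> bool" where
  "adds_one_edge V E E' \<longleftrightarrow>
     (\<exists>u\<in>V. \<exists>v\<in>V. u \<noteq> v \<and> {u, v} \<notin> E \<and> E' = insert {u, v} E)"

end

theory Submission
  imports Defs
begin

text \<open>
  For a disjoint union of two edges, the cut separating the components shows that the
  infimum is \<open>0\<close>. Joining the components yields a path on four vertices; every cut of a
  connected graph crosses an edge, so its infimum over the finitely many cuts is positive.
  For this path it equals \<open>2/3\<close>, attained at the middle edge.
\<close>

definition two_edges :: "nat set set" where
  "two_edges = {{0, 1}, {2, 3}}"

definition path4 :: "nat set set" where
  "path4 = insert {1, 2} two_edges"

lemma simple_graph_path4: "simple_graph {0, 1, 2, 3} path4"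
  by (simp add: simple_graph_def path4_def two_edges_def)

lemma simple_graph_two_edges: "simple_graph {0, 1, 2, 3} two_edges"
  by (simp add: simple_graph_def two_edges_def)

lemma adds_one_edge_path4: "adds_one_edge {0, 1, 2, 3} two_edges path4"
  unfolding adds_one_edge_def
  by (rule bexI[of _ 1], rule bexI[of _ 2])
    (simp_all add: path4_def two_edges_def doubleton_eq_iff)

lemma degree_two_edges:
  assumes "v \<in> {0, 1, 2, 3}"
  shows "degree two_edges v = 1"
proof -
  have "{e \<in> two_edges. v \<in> e} = {if v < 2 then {0, 1} else {2, 3}}"
    using assms by (auto simp: two_edges_def)
  then show ?thesis
    by (simp add: degree_def)
qed

lemma degree_path4:
  "degree path4 0 = 1" "degree path4 1 = 2" "degree path4 2 = 2" "degree path4 3 = 1"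
proof -
  have "{e \<in> path4. 0 \<in> e} = {{0, 1}}" "{e \<in> path4. 1 \<in> e} = {{0, 1}, {1, 2}}"
    "{e \<in> path4. 2 \<in> e} = {{1, 2}, {2, 3}}" "{e \<in> path4. 3 \<in> e} = {{2, 3}}"
    by (auto simp: path4_def two_edges_def)
  then show "degree path4 0 = 1" "degree path4 1 = 2" "degree path4 2 = 2" "degree path4 3 = 1"
    by (simp_all add: degree_def doubleton_eq_iff)
qed

lemma lambda_two_edges_le: "lambda {0, 1, 2, 3} two_edges K2 \<le> 0"
proof -
  define f :: "nat \<Rightarrow> bool" where "f v \<longleftrightarrow> v < 2" for v
  have "edge_energy {0, 1, 2, 3} two_edges K2 f = 0"
    unfolding edge_energy_def
    by (auto simp: f_def two_edges_def doubleton_eq_iff mdist_K2 intro!: sum.neutral)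
  then have "rayleigh {0, 1, 2, 3} two_edges K2 f = 0"
    by (simp add: rayleigh_def)
  \<comment> \<open>The quotient is 0 whatever the denominator is, so admissibility of
    \<open>f\<close> needs its own check: four pairs cross the cut, each with degree product
    1.\<close>
  moreover have "pair_energy {0, 1, 2, 3} two_edges K2 f \<noteq> 0"
    by (simp add: pair_energy_def sum.cartesian_product[symmetric] f_def degree_two_edges mdist_K2)
  ultimately show ?thesis
    unfolding lambda_def by (intro INF_lower2[of f]) (auto simp: mspace_K2)
qed

text \<open>A cut with \<open>c\<close> crossing edges and degree sum \<open>s\<close> on one side
  has quotient \<open>6 * c / (s * (6 - s))\<close>. Here \<open>c\<close> is at least 1 by
  connectedness and \<open>s * (6 - s)\<close> is at most 9, whence 2/3. The proof checks all cuts
  directly.\<close>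

lemma rayleigh_path4_ge:
  assumes "pair_energy {0, 1, 2, 3} path4 K2 f \<noteq> 0"
  shows "rayleigh {0, 1, 2, 3} path4 K2 f \<ge> 2 / 3"
proof -
  have "{(u, v). u \<in> {0, 1, 2, 3} \<and> v \<in> {0, 1, 2, 3} \<and> {u, v} \<in> path4}
      = {(0, 1), (1, 0), (1, 2), (2, 1), (2, 3), (3, 2)}"
    by (auto simp: path4_def two_edges_def doubleton_eq_iff)
  then have "edge_energy {0, 1, 2, 3} path4 K2 f
      = of_bool (f 0 \<noteq> f 1) + of_bool (f 1 \<noteq> f 2) + of_bool (f 2 \<noteq> f 3)"
    unfolding edge_energy_def by (simp add: mdist_K2)
  moreover have "vol {0, 1, 2, 3} path4 = 6"
    \<comment> \<open>The simplifier turns the vertex \<open>1\<close> into \<open>Suc 0\<close>, so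
      the degree fact is also supplied in that form.\<close>
    by (simp add: vol_def degree_path4 degree_path4(2)[simplified])
  \<comment> \<open>Each coefficient is a product of two degrees; the halving cancels against the
    two orders of a pair.\<close>
  moreover have "pair_energy {0, 1, 2, 3} path4 K2 f
      = 2 * of_bool (f 0 \<noteq> f 1) + 2 * of_bool (f 0 \<noteq> f 2) + of_bool (f 0 \<noteq> f 3)
        + 4 * of_bool (f 1 \<noteq> f 2) + 2 * of_bool (f 1 \<noteq> f 3) + 2 * of_bool (f 2 \<noteq> f 3)"
    by (simp add: pair_energy_def sum.cartesian_product[symmetric] mdist_K2
        degree_path4 degree_path4(2)[simplified])
  ultimately show ?thesis
    \<comment> \<open>Of the 16 assignments, the assumption excludes the two constant ones.\<close>
    using assms unfolding rayleigh_def
    by (cases "f 0"; cases "f 1"; cases "f 2"; cases "f 3") simp_all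
qed

lemma lambda_path4_ge: "lambda {0, 1, 2, 3} path4 K2 \<ge> ereal (2 / 3)"
  unfolding lambda_def
  by (blast intro: INF_greatest iffD2[OF ereal_less_eq(3)] rayleigh_path4_ge)

theorem theorem6p3:
  shows "\<exists>(V :: nat set) E E'.
    simple_graph V E \<and> simple_graph V E' \<and> adds_one_edge V E E' \<and>
    lambda V E K2 < lambda V E' K2"
proof -
  have "lambda {0, 1, 2, 3} two_edges K2 \<le> 0"
    by (rule lambda_two_edges_le)
  also have "0 < ereal (2 / 3)"
    by simp
  also have "\<dots> \<le> lambda {0, 1, 2, 3} path4 K2"
    by (rule lambda_path4_ge)
  finally show ?thesis
    using simple_graph_two_edges simple_graph_path4 adds_one_edge_path4 by blast
qed

end
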